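(* There is a semi-decidable FC equivalence relation $E$ on $\mathbb{N}$ such that (a) there do not exist $n>1$ and decidable equivalence relations $H_1,\dots,H_n$ on $\mathbb{N}$ that satisfy $E=\bigvee_{i\le n} H_i$, and (b) there do not exist $n>1$ and decidable equivalence relations $H_1,\dots,H_n$ on $\mathbb{N}$ (not necessarily distinct) such that $E=H_1\cdots H_n$.
   Context: $\mathbb{N}=\{0,1,2,\dots\}$. Relations are subsets of $\mathbb{N}\times\mathbb{N}$. "Decidable" means recursive; "semi-decidable" means recursively enumerable. An equivalence relation on $\mathbb{N}$ is called FC if every one of its equivalence classes is finite. The composition of binary relations is $RS=\{(x,z) : \exists y\, [(x,y)\in R \text{ and } (y,z)\in S]\}$, and $H_1\cdots H_n$ is the iterated composition. $\bigvee_{i\le n}H_i$ denotes the join in the lattice of equivalence relations, i.e. the transitive closure of $H_1\cup\dots\cup H_n$. *)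

theory Defs
  imports Main
begin

text \<open>
  Partial recursive functions on the natural numbers, as programs built from the zero functions
  (of every arity), the successor and the projections by composition, primitive recursion and
  unbounded minimisation. The list of arguments fixes the arity. \<open>Proj i\<close> counts from 0, and both
  \<open>Prec\<close> and \<open>Mu\<close> act on the first argument.
\<close>

datatype recf =
    Zero
  | Succ
  | Proj nat
  | Comp recf "recf list"
  | Prec recf recf
  | Mu recf

text \<open>\<open>computes f xs y\<close>: the program \<open>f\<close> halts on the arguments \<open>xs\<close> with value \<open>y\<close>.\<close>

inductive computes :: "recf \<Rightarrow> nat list \<Rightarrow> nat \<Rightarrow> bool" where
  zero: "computes Zero xs 0"
| succ: "computes Succ [x] (Suc x)"
| proj: "i < length xs \<Longrightarrow> computes (Proj i) xs (xs ! i)"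
| comp: "list_all2 (\<lambda>g y. computes g xs y) gs ys \<Longrightarrow> computes f ys z \<Longrightarrow>
    computes (Comp f gs) xs z"
| prec_0: "computes f xs y \<Longrightarrow> computes (Prec f g) (0 # xs) y"
| prec_Suc: "computes (Prec f g) (n # xs) y \<Longrightarrow> computes g (n # y # xs) z \<Longrightarrow>
    computes (Prec f g) (Suc n # xs) z"
| mu: "computes f (n # xs) 0 \<Longrightarrow> (\<And>m. m < n \<Longrightarrow> \<exists>k. computes f (m # xs) (Suc k)) \<Longrightarrow>
    computes (Mu f) xs n"

lemma computes_deterministic: "computes f xs y \<Longrightarrow> computes f xs z \<Longrightarrow> y = z"
proof (induction arbitrary: z rule: computes.induct)
  case (comp xs gs ys f w)
  from comp.prems obtain ys' where ys': "list_all2 (\<lambda>g y. computes g xs y) gs ys'"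
    and f: "computes f ys' z"
    by (cases rule: computes.cases) auto
  have "ys = ys'"
    using comp.IH(1) ys' by (auto simp: list_all2_conv_all_nth intro!: nth_equalityI)
  then show ?case using comp.IH(2) f by simp
next
  case (prec_Suc f g n xs y w)
  from prec_Suc.prems obtain y' where "computes (Prec f g) (n # xs) y'"
    and "computes g (n # y' # xs) z"
    by (cases rule: computes.cases) auto
  then show ?case using prec_Suc.IH by blast
next
  case (mu f n xs)
  from mu.prems have z: "computes f (z # xs) 0 \<and> (\<forall>m<z. \<exists>k. computes f (m # xs) (Suc k))"
    by (cases rule: computes.cases) auto
  have "\<not> n < z" using z mu.IH(1) by blast
  moreover have "\<not> z < n" using mu.IH(2)[of z] z by blast
  ultimately show ?case by simp
qed (erule computes.cases; simp)+

definition decidable_rel :: "nat rel \<Rightarrow> bool" where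
  "decidable_rel R \<longleftrightarrow> (\<exists>f. \<forall>x y. computes f [x, y] (if (x, y) \<in> R then 1 else 0))"

definition semi_decidable_rel :: "nat rel \<Rightarrow> bool" where
  "semi_decidable_rel R \<longleftrightarrow> (\<exists>f. \<forall>x y. (x, y) \<in> R \<longleftrightarrow> (\<exists>z. computes f [x, y] z))"

definition FC :: "nat rel \<Rightarrow> bool" where
  "FC E \<longleftrightarrow> (\<forall>C \<in> UNIV // E. finite C)"

end

theory Submission
  imports Defs "HOL-Library.Nat_Bijection"
begin

text \<open>The finite join of decidable equivalence relations is generated by their union \<open>D\<close>, which is a
  decidable relation. The block \<open>{2 e, 2 e + 1}\<close> diagonalises against the \<open>e\<close>-th program: its two
  elements are joined iff this program halts with the value \<open>0\<close> on them. If \<open>e\<close> is a program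
  deciding \<open>D\<close>, then the two elements are equivalent iff they are not related by \<open>D\<close>, which is absurd
  if \<open>D\<close> generates the equivalence relation. A composition of equivalence relations that is an
  equivalence relation is their join, so (b) reduces to (a).\<close>

section \<open>Total recursive functions\<close>

text \<open>Speaking of functions on argument lists hides the programs, so that recursiveness of a
  term is proved by following its syntax with \<open>recursive_intros\<close>.\<close>

definition recursive :: "nat \<Rightarrow> (nat list \<Rightarrow> nat) \<Rightarrow> bool" where
  "recursive k g \<longleftrightarrow> (\<exists>p. \<forall>xs. length xs = k \<longrightarrow> computes p xs (g xs))"

named_theorems recursive_intros

lemma recursive_nth [recursive_intros]: "i < k \<Longrightarrow> recursive k (\<lambda>xs. xs ! i)"
  unfolding recursive_def by (metis computes.proj)

lemma recursive_comp:
  assumes "recursive (length gs) h" "\<And>g. g \<in> set gs \<Longrightarrow> recursive k g"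
  shows "recursive k (\<lambda>xs. h (map (\<lambda>g. g xs) gs))"
proof -
  obtain p where p: "length ys = length gs \<Longrightarrow> computes p ys (h ys)" for ys
    using assms(1) unfolding recursive_def by blast
  have "\<exists>q. \<forall>g\<in>set gs. \<forall>xs. length xs = k \<longrightarrow> computes (q g) xs (g xs)"
    using assms(2) unfolding recursive_def by (intro bchoice) blast
  then obtain q where q: "g \<in> set gs \<Longrightarrow> length xs = k \<Longrightarrow> computes (q g) xs (g xs)" for g xs
    by blast
  have "computes (Comp p (map q gs)) xs (h (map (\<lambda>g. g xs) gs))" if "length xs = k" for xs
    using p q that
    by (intro computes.comp[where ys = "map (\<lambda>g. g xs) gs"]) (auto simp: list_all2_conv_all_nth)
  then show ?thesis unfolding recursive_def by blast
qed

lemma recursive_comp1: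
  assumes "recursive 1 (\<lambda>xs. h (xs ! 0))" "recursive k f"
  shows "recursive k (\<lambda>xs. h (f xs))"
  using recursive_comp[of "[f]" "\<lambda>xs. h (xs ! 0)" k] assms by simp

lemma recursive_comp2:
  assumes "recursive 2 (\<lambda>xs. h (xs ! 0) (xs ! 1))" "recursive k f" "recursive k g"
  shows "recursive k (\<lambda>xs. h (f xs) (g xs))"
  using recursive_comp[of "[f, g]" "\<lambda>xs. h (xs ! 0) (xs ! 1)" k] assms
  by (auto simp: numeral_2_eq_2)

lemma recursive_comp3:
  assumes "recursive 3 (\<lambda>xs. h (xs ! 0) (xs ! 1) (xs ! 2))"
    "recursive k f" "recursive k g" "recursive k g'"
  shows "recursive k (\<lambda>xs. h (f xs) (g xs) (g' xs))"
  using recursive_comp[of "[f, g, g']" "\<lambda>xs. h (xs ! 0) (xs ! 1) (xs ! 2)" k] assms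
  by (auto simp: numeral_3_eq_3)

lemma recursive_Suc [recursive_intros]:
  assumes "recursive k f" shows "recursive k (\<lambda>xs. Suc (f xs))"
proof -
  have "recursive 1 (\<lambda>xs. Suc (xs ! 0))"
    unfolding recursive_def
    by (rule exI[of _ Succ]) (auto simp: length_Suc_conv intro: computes.succ)
  then show ?thesis using assms by (rule recursive_comp1)
qed

lemma recursive_const [recursive_intros]: "recursive k (\<lambda>_. c)"
proof (induction c)
  case 0
  show ?case unfolding recursive_def by (blast intro: computes.zero)
qed (rule recursive_Suc)

text \<open>Asking only for recursion equations of a given \<open>h\<close> lets existing functions
  such as addition and \<open>triangle\<close> be treated directly.\<close>

lemma recursive_primrec:
  assumes "recursive k f" "recursive (Suc (Suc k)) g"
    and h: "\<And>xs. length xs = k \<Longrightarrow> h (0 # xs) = f xs"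
      "\<And>n xs. length xs = k \<Longrightarrow> h (Suc n # xs) = g (n # h (n # xs) # xs)"
  shows "recursive (Suc k) h"
proof -
  obtain p q where p: "length xs = k \<Longrightarrow> computes p xs (f xs)"
    and q: "length xs = Suc (Suc k) \<Longrightarrow> computes q xs (g xs)" for xs
    using assms(1,2) unfolding recursive_def by blast
  have "computes (Prec p q) (n # xs) (h (n # xs))" if "length xs = k" for n xs
    using that by (induction n) (auto simp: h intro!: computes.prec_0 p computes.prec_Suc q)
  then show ?thesis
    unfolding recursive_def by (intro exI[of _ "Prec p q"]) (auto simp: length_Suc_conv)
qed

text \<open>The zero at \<open>h xs\<close> makes the search by \<open>Mu\<close> halt, and it stops
  exactly there because every earlier value is a successor.\<close>

lemma recursive_least:
  assumes "recursive (Suc k) f"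
    and zero: "\<And>xs. length xs = k \<Longrightarrow> f (h xs # xs) = 0"
    and least: "\<And>xs m. length xs = k \<Longrightarrow> f (m # xs) = 0 \<Longrightarrow> h xs \<le> m"
  shows "recursive k h"
proof -
  obtain p where p: "length xs = Suc k \<Longrightarrow> computes p xs (f xs)" for xs
    using assms(1) unfolding recursive_def by blast
  have "computes (Mu p) xs (h xs)" if k: "length xs = k" for xs
  proof (rule computes.mu)
    show "computes p (h xs # xs) 0"
      using p[of "h xs # xs"] zero[OF k] k by simp
    show "\<exists>j. computes p (m # xs) (Suc j)" if "m < h xs" for m
      using p[of "m # xs"] least[OF k, of m] that k by (cases "f (m # xs)") auto
  qed
  then show ?thesis unfolding recursive_def by blast
qed

lemma recursive_add [recursive_intros]:
  assumes "recursive k f" "recursive k g" shows "recursive k (\<lambda>xs. f xs + g xs)"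
proof -
  have "recursive 2 (\<lambda>xs. xs ! 0 + xs ! 1)"
    unfolding numeral_2_eq_2
    by (rule recursive_primrec[where f = "\<lambda>xs. xs ! 0" and g = "\<lambda>xs. Suc (xs ! 1)"])
       (auto intro!: recursive_intros)
  then show ?thesis using assms by (rule recursive_comp2)
qed

lemma recursive_diff [recursive_intros]:
  assumes "recursive k f" "recursive k g" shows "recursive k (\<lambda>xs. f xs - g xs)"
proof -
  have "recursive (Suc 0) (\<lambda>xs. xs ! 0 - 1)"
    by (rule recursive_primrec[where f = "\<lambda>_. 0" and g = "\<lambda>xs. xs ! 0"])
       (auto intro!: recursive_intros)
  from recursive_comp1[OF this[folded One_nat_def]]
  have pred: "recursive k f \<Longrightarrow> recursive k (\<lambda>xs. f xs - 1)" for k f .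
  \<comment> \<open>Recursion acts on the first argument, so the subtrahend is placed there and the
    arguments are swapped back at the end.\<close>
  have "recursive 2 (\<lambda>xs. xs ! 1 - xs ! 0)"
    unfolding numeral_2_eq_2
    by (rule recursive_primrec[where f = "\<lambda>xs. xs ! 0" and g = "\<lambda>xs. xs ! 1 - 1", OF _ pred])
       (auto intro!: recursive_intros)
  from recursive_comp2[where h = "\<lambda>a b. b - a", OF this assms(2,1)] show ?thesis .
qed

lemma recursive_if_eq [recursive_intros]:
  assumes "recursive k f" "recursive k g" "recursive k a" "recursive k b"
  shows "recursive k (\<lambda>xs. if f xs = g xs then a xs else b xs)"
proof -
  \<comment> \<open>A recursion that ignores its previous value is a case distinction on
    \<open>0\<close>. Its step sees the counter, the previous value, \<open>u\<close> and
    \<open>v\<close>, so index 3 is \<open>v\<close>.\<close>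
  have "recursive 3 (\<lambda>xs. (\<lambda>n u v. if n = 0 then u else v) (xs ! 0) (xs ! 1) (xs ! 2))"
    unfolding numeral_3_eq_3
    by (rule recursive_primrec[where f = "\<lambda>xs. xs ! 0" and g = "\<lambda>xs. xs ! 3"])
       (auto intro!: recursive_intros)
  then have "recursive k (\<lambda>xs. if (f xs - g xs) + (g xs - f xs) = 0 then a xs else b xs)"
    by (rule recursive_comp3) (intro recursive_intros assms)+
  moreover have "(if m - n + (n - m) = 0 then u else v) = (if m = n then u else v)"
    for m n u v :: nat by auto
  ultimately show ?thesis by simp
qed

lemma recursive_triangle [recursive_intros]:
  assumes "recursive k f" shows "recursive k (\<lambda>xs. triangle (f xs))"
proof -
  have "recursive (Suc 0) (\<lambda>xs. triangle (xs ! 0))"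
    by (rule recursive_primrec[where f = "\<lambda>_. 0" and g = "\<lambda>xs. xs ! 1 + Suc (xs ! 0)"])
       (auto intro!: recursive_intros)
  then have "recursive 1 (\<lambda>xs. triangle (xs ! 0))" by simp
  then show ?thesis using assms by (rule recursive_comp1)
qed

lemma recursive_funpow:
  assumes "recursive 1 (\<lambda>xs. h (xs ! 0))" "recursive k f" "recursive k g"
  shows "recursive k (\<lambda>xs. (h ^^ f xs) (g xs))"
proof -
  have "recursive 2 (\<lambda>xs. (h ^^ (xs ! 0)) (xs ! 1))"
    unfolding numeral_2_eq_2
    by (rule recursive_primrec[where f = "\<lambda>xs. xs ! 0" and g = "\<lambda>xs. h (xs ! 1)"])
       (auto intro!: recursive_intros recursive_comp1[OF assms(1)])
  from recursive_comp2[OF this assms(2,3)] show ?thesis .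
qed

section \<open>Cantor pairing and its inverse\<close>

abbreviation pair :: "nat \<Rightarrow> nat \<Rightarrow> nat" where
  "pair a b \<equiv> prod_encode (a, b)"

definition pfst :: "nat \<Rightarrow> nat" where "pfst z = fst (prod_decode z)"
definition psnd :: "nat \<Rightarrow> nat" where "psnd z = snd (prod_decode z)"

lemma pfst_pair [simp]: "pfst (pair a b) = a" and psnd_pair [simp]: "psnd (pair a b) = b"
  by (auto simp: pfst_def psnd_def)

lemma pair_0_0 [simp]: "pair 0 0 = 0"
  by (simp add: prod_encode_def)

lemma pfst_0 [simp]: "pfst 0 = 0"
  using pfst_pair[of 0 0] by simp

lemma triangle_mono: "m \<le> n \<Longrightarrow> triangle m \<le> triangle n"
  by (induction rule: dec_induct) auto

lemma recursive_pair [recursive_intros]: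
  assumes "recursive k f" "recursive k g" shows "recursive k (\<lambda>xs. pair (f xs) (g xs))"
  unfolding prod_encode_def by (auto intro!: recursive_intros assms)

text \<open>As \<open>pair a b = triangle (a + b) + a\<close>, the sum \<open>a + b\<close> is the
  least \<open>m\<close> with \<open>pair a b < triangle (Suc m)\<close>, which a search finds. Both
  projections follow from it by subtraction.\<close>

lemma recursive_pfst_plus_psnd:
  assumes "recursive k f" shows "recursive k (\<lambda>xs. pfst (f xs) + psnd (f xs))"
proof -
  have "recursive 1 (\<lambda>xs. pfst (xs ! 0) + psnd (xs ! 0))"
  proof (rule recursive_least)
    show "recursive (Suc 1) (\<lambda>xs. Suc (xs ! 1) - triangle (Suc (xs ! 0)))"
      by (intro recursive_intros) auto
    fix xs :: "nat list" and m
    obtain a b where ab: "xs ! 0 = pair a b" by (metis prod_decode_inverse surj_pair)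
    show "Suc (((pfst (xs ! 0) + psnd (xs ! 0)) # xs) ! 1)
        - triangle (Suc (((pfst (xs ! 0) + psnd (xs ! 0)) # xs) ! 0)) = 0"
      by (simp add: ab) (simp add: prod_encode_def)
    assume "Suc ((m # xs) ! 1) - triangle (Suc ((m # xs) ! 0)) = 0"
    then show "pfst (xs ! 0) + psnd (xs ! 0) \<le> m"
      using triangle_mono[of "Suc m" "a + b"]
      by (cases "a + b \<le> m") (simp_all add: ab, simp add: prod_encode_def)
  qed
  then show ?thesis using assms by (rule recursive_comp1)
qed

lemma recursive_pfst [recursive_intros]:
  assumes "recursive k f" shows "recursive k (\<lambda>xs. pfst (f xs))"
proof -
  have "pfst z = z - triangle (pfst z + psnd z)" for z
    using prod_decode_inverse[of z]
    by (cases "prod_decode z") (auto simp: pfst_def psnd_def prod_encode_def)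
  then have "(\<lambda>xs. pfst (f xs)) = (\<lambda>xs. f xs - triangle (pfst (f xs) + psnd (f xs)))" by blast
  then show ?thesis
    using recursive_diff[OF assms recursive_triangle[OF recursive_pfst_plus_psnd[OF assms]]]
    by (rule ssubst[where P = "recursive k"])
qed

lemma recursive_psnd [recursive_intros]:
  assumes "recursive k f" shows "recursive k (\<lambda>xs. psnd (f xs))"
  using recursive_diff[OF recursive_pfst_plus_psnd recursive_pfst, OF assms assms] by simp

lemma recursive_div2 [recursive_intros]:
  assumes "recursive k f" shows "recursive k (\<lambda>xs. f xs div 2)"
proof -
  have "recursive 1 (\<lambda>xs. xs ! 0 div 2)"
    \<comment> \<open>The quotient of \<open>z\<close> by 2 is the least \<open>q\<close> with
      \<open>z < 2 * q + 2\<close>.\<close>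
    by (rule recursive_least[where f = "\<lambda>xs. Suc (xs ! 1) - (xs ! 0 + xs ! 0 + 2)"])
       (auto intro!: recursive_intros)
  then show ?thesis using assms by (rule recursive_comp1)
qed

section \<open>Decidable and semi-decidable relations\<close>

lemma decidable_rel_iff_recursive:
  "decidable_rel R \<longleftrightarrow> recursive 2 (\<lambda>xs. if (xs ! 0, xs ! 1) \<in> R then 1 else 0)"
proof
  assume "decidable_rel R"
  then obtain f where "\<forall>x y. computes f [x, y] (if (x, y) \<in> R then 1 else 0)"
    unfolding decidable_rel_def by blast
  then show "recursive 2 (\<lambda>xs. if (xs ! 0, xs ! 1) \<in> R then 1 else 0)"
    unfolding recursive_def
    by (intro exI[of _ f])
       (auto simp: numeral_2_eq_2 length_Suc_conv simp del: One_nat_def split del: if_split)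
next
  assume "recursive 2 (\<lambda>xs. if (xs ! 0, xs ! 1) \<in> R then 1 else 0)"
  then obtain f where f: "length xs = 2 \<Longrightarrow>
      computes f xs (if (xs ! 0, xs ! 1) \<in> R then 1 else 0)" for xs
    unfolding recursive_def by blast
  show "decidable_rel R"
    unfolding decidable_rel_def using f[of "[_, _]"]
    by (intro exI[of _ f] allI) (simp del: One_nat_def split del: if_split)
qed

lemma decidable_rel_empty: "decidable_rel {}"
  by (auto simp: decidable_rel_iff_recursive intro: recursive_intros)

lemma decidable_rel_Un:
  assumes "decidable_rel R" "decidable_rel S" shows "decidable_rel (R \<union> S)"
proof -
  let ?\<chi> = "\<lambda>R xs. if (xs ! 0, xs ! 1) \<in> R then 1 else 0 :: nat"
  have "recursive 2 (\<lambda>xs. if ?\<chi> R xs = 1 then 1 else ?\<chi> S xs)"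
    using assms unfolding decidable_rel_iff_recursive by (intro recursive_if_eq recursive_const)
  moreover have "(\<lambda>xs. if ?\<chi> R xs = 1 then 1 else ?\<chi> S xs) = ?\<chi> (R \<union> S)" by auto
  ultimately show ?thesis unfolding decidable_rel_iff_recursive by simp
qed

lemma decidable_rel_Union: "\<forall>H\<in>set Hs. decidable_rel H \<Longrightarrow> decidable_rel (\<Union> (set Hs))"
  by (induction Hs) (auto intro: decidable_rel_empty decidable_rel_Un)

text \<open>As \<open>f\<close> is total, the search for its first zero halts iff there is a zero;
  determinism shows that a value found by the search is indeed a zero.\<close>

lemma semi_decidable_rel_search:
  assumes "recursive 3 f" "\<And>x y. (x, y) \<in> R \<longleftrightarrow> (\<exists>n. f [n, x, y] = 0)"
  shows "semi_decidable_rel R"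
proof -
  obtain p where "length xs = 3 \<Longrightarrow> computes p xs (f xs)" for xs
    using assms(1) unfolding recursive_def by blast
  then have p: "computes p [n, x, y] (f [n, x, y])" for n x y by simp
  have "(x, y) \<in> R \<longleftrightarrow> (\<exists>z. computes (Mu p) [x, y] z)" for x y
  proof
    assume "(x, y) \<in> R"
    then have "\<exists>n. f [n, x, y] = 0" using assms(2) by simp
    then obtain n where n: "f [n, x, y] = 0" "\<And>m. m < n \<Longrightarrow> f [m, x, y] \<noteq> 0"
      using exists_least_iff[of "\<lambda>n. f [n, x, y] = 0"] by auto
    then have "computes (Mu p) [x, y] n"
      by (intro computes.mu) (metis p, metis p not0_implies_Suc)
    then show "\<exists>z. computes (Mu p) [x, y] z" by blast
  next
    assume "\<exists>z. computes (Mu p) [x, y] z"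
    then obtain z where "computes p [z, x, y] 0" by (auto elim: computes.cases)
    then have "f [z, x, y] = 0" using computes_deterministic p by blast
    then show "(x, y) \<in> R" using assms(2) by blast
  qed
  then show ?thesis unfolding semi_decidable_rel_def by blast
qed

section \<open>A universal stack machine\<close>

text \<open>A configuration is \<^term>\<open>pair k s\<close> with a stack \<open>k\<close> of instructions still to be executed and
  a stack \<open>s\<close> of data; stacks are nested pairs ending in \<open>0\<close>. An instruction is a pair of an opcode
  and an operand. As \<^term>\<open>pair 0 0 = 0\<close>, the empty instruction stack has opcode \<open>0\<close> on top and halts
  the machine, and the configuration that has halted with the value \<open>0\<close> is the number \<open>0\<close>.\<close>

definition "iseq a b = pair 1 (pair a b)"
definition "izero = pair 2 0"
definition "iinc = pair 3 0"
definition "ihead = pair 4 0"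
definition "itail = pair 5 0"
definition "idup = pair 6 0"
definition "iswap = pair 7 0"
definition "icons = pair 8 0"
definition "iprec f g = pair 9 (pair f g)"
definition "icomb = pair 10 0"
definition "iloop f = pair 11 f"
definition "itest f = pair 12 f"

lemmas instr_defs = iseq_def izero_def iinc_def ihead_def itail_def idup_def iswap_def icons_def
  iprec_def icomb_def iloop_def itest_def

text \<open>Here \<open>t\<close> is the top datum and \<open>s\<close> the data below. Opcode 9
  keeps a copy of the decremented argument, recurses on another one, and leaves \<open>icomb\<close>
  to build the argument of the step program. Opcode 11 runs the body on a copy of the candidate;
  opcode 12 then returns the counter or increments it and loops.\<close>

definition exec :: "nat \<Rightarrow> nat \<Rightarrow> nat \<Rightarrow> nat \<Rightarrow> nat \<Rightarrow> nat" where
  "exec opc a k t s =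
    (if opc = 1 then pair (pair (pfst a) (pair (psnd a) k)) (pair t s)
     else if opc = 2 then pair k (pair 0 s)
     else if opc = 3 then pair k (pair (Suc t) s)
     else if opc = 4 then pair k (pair (pfst t) s)
     else if opc = 5 then pair k (pair (psnd t) s)
     else if opc = 6 then pair k (pair t (pair t s))
     else if opc = 7 then pair k (pair (pfst s) (pair t (psnd s)))
     else if opc = 8 then pair k (pair (pair t (pfst s)) (psnd s))
     else if opc = 9 then
       (if pfst t = 0 then pair (pair (pfst a) k) (pair (psnd t) s)
        else pair (pair (pair 9 a) (pair icomb (pair (psnd a) k)))
          (pair (pair (pfst t - 1) (psnd t)) (pair (pair (pfst t - 1) (psnd t)) s)))
     else if opc = 10 then
       pair k (pair (pair (pfst (pfst s)) (pair t (psnd (pfst s)))) (psnd s))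
     else if opc = 11 then pair (pair a (pair (itest a) k)) (pair t (pair t s))
     else
       (if t = 0 then pair k (pair (pfst (pfst s)) (psnd s))
        else pair (pair (iloop a) k)
          (pair (pair (Suc (pfst (pfst s))) (psnd (pfst s))) (psnd s))))"

definition step :: "nat \<Rightarrow> nat" where
  "step c = (if pfst (pfst (pfst c)) = 0 then c
     else exec (pfst (pfst (pfst c))) (psnd (pfst (pfst c))) (psnd (pfst c))
       (pfst (psnd c)) (psnd (psnd c)))"

text \<open>Every number is read as a configuration, so \<open>step\<close> is total and built from
  pairing, projections, arithmetic and equality tests. Reaching a given configuration thereby
  becomes semi-decidable.\<close>

lemma recursive_step: "recursive 1 (\<lambda>xs. step (xs ! 0))"
  unfolding step_def exec_def instr_defs by (intro recursive_intros) auto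

definition run :: "nat \<Rightarrow> nat \<Rightarrow> bool" where
  "run c d \<longleftrightarrow> (\<exists>n. (step ^^ n) c = d)"

lemma run_refl [simp]: "run c c"
  unfolding run_def by (rule exI[of _ 0]) simp

lemma run_trans: "run c d \<Longrightarrow> run d d' \<Longrightarrow> run c d'"
  unfolding run_def by (metis funpow_add comp_apply)

lemma run_step: "step c = c' \<Longrightarrow> run c' d \<Longrightarrow> run c d"
  unfolding run_def by (metis funpow_Suc_right comp_apply)

lemma
  shows step_iseq: "step (pair (pair (iseq a b) k) s) = pair (pair a (pair b k)) s" 
  and step_izero: "step (pair (pair izero k) (pair t s)) = pair k (pair 0 s)"
  and step_iinc: "step (pair (pair iinc k) (pair t s)) = pair k (pair (Suc t) s)"
  and step_ihead: "step (pair (pair ihead k) (pair t s)) = pair k (pair (pfst t) s)"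
  and step_itail: "step (pair (pair itail k) (pair t s)) = pair k (pair (psnd t) s)"
  and step_idup: "step (pair (pair idup k) (pair t s)) = pair k (pair t (pair t s))"
  and step_iswap: "step (pair (pair iswap k) (pair t (pair u s))) = pair k (pair u (pair t s))"
  and step_icons: "step (pair (pair icons k) (pair t (pair u s))) = pair k (pair (pair t u) s)"
  and step_iprec_0: "step (pair (pair (iprec f g) k) (pair (pair 0 x) s)) = pair (pair f k) (pair x s)"
  and step_iprec_Suc: "step (pair (pair (iprec f g) k) (pair (pair (Suc n) x) s)) =
     pair (pair (iprec f g) (pair icomb (pair g k))) (pair (pair n x) (pair (pair n x) s))"
  and step_icomb: "step (pair (pair icomb k) (pair y (pair (pair n x) s))) = pair k (pair (pair n (pair y x)) s)"
  and step_iloop: "step (pair (pair (iloop f) k) (pair t s)) = pair (pair f (pair (itest f) k)) (pair t (pair t s))"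
  and step_itest_0: "step (pair (pair (itest f) k) (pair 0 (pair (pair n x) s))) = pair k (pair n s)"
  and step_itest_Suc: "step (pair (pair (itest f) k) (pair (Suc v) (pair (pair n x) s))) =
     pair (pair (iloop f) k) (pair (pair (Suc n) x) s)"
  by (simp_all add: step_def exec_def instr_defs pfst_def psnd_def)

lemmas step_simps =
  step_iseq step_izero step_iinc step_ihead step_itail step_idup step_iswap
  step_icons step_iprec_0 step_iprec_Suc step_icomb step_iloop step_itest_0 step_itest_Suc

text \<open>Used backwards, these rules execute the machine symbolically.\<close>

lemmas run_intros = run_refl step_simps[THEN run_step]

section \<open>Compiling programs to machine code\<close>

definition enc :: "nat list \<Rightarrow> nat" where
  "enc xs = foldr pair xs 0"

lemma enc_simps [simp]: "enc [] = 0" "enc (x # xs) = pair x (enc xs)"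
  by (simp_all add: enc_def)

text \<open>The argument is duplicated; one copy becomes the list of the remaining values, the other
  the first value, and \<open>icons\<close> joins them. The final \<open>izero\<close> yields the
  empty list, coded by \<open>0\<close>.\<close>

definition itup :: "nat list \<Rightarrow> nat" where
  "itup gs = foldr (\<lambda>g l. iseq idup (iseq l (iseq iswap (iseq g icons)))) gs izero"

primrec compile :: "recf \<Rightarrow> nat" where
  "compile Zero = izero"
| "compile Succ = iseq ihead iinc"
| "compile (Proj i) = (iseq itail ^^ i) ihead"
| "compile (Comp f gs) = iseq (itup (map compile gs)) (compile f)"
| "compile (Prec f g) = iprec (compile f) (compile g)"
| "compile (Mu f) = iseq idup (iseq izero (iseq icons (iloop (compile f))))"

text \<open>Quantifying over the pending instructions \<open>k\<close> and the data \<open>s\<close>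
  below lets such computations be inserted in any context.\<close>

definition evaluates :: "nat \<Rightarrow> nat \<Rightarrow> nat \<Rightarrow> bool" where
  "evaluates i t u \<longleftrightarrow> (\<forall>k s. run (pair (pair i k) (pair t s)) (pair k (pair u s)))"

lemma evaluatesD: "evaluates i t u \<Longrightarrow> run (pair (pair i k) (pair t s)) (pair k (pair u s))"
  unfolding evaluates_def by blast

lemma run_evaluates:
  assumes "evaluates i t u" "run (pair k (pair u s)) d"
  shows "run (pair (pair i k) (pair t s)) d"
  using evaluatesD[OF assms(1)] assms(2) by (rule run_trans)

lemma evaluates_iseq:
  assumes "evaluates a t u" "evaluates b u v"
  shows "evaluates (iseq a b) t v"
  unfolding evaluates_def[of "iseq a b"]
  by (intro allI run_step[OF step_iseq] assms[THEN run_evaluates] run_refl)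

lemma evaluates_basic:
  "evaluates izero t 0" "evaluates iinc t (Suc t)" "evaluates ihead t (pfst t)"
  "evaluates itail t (psnd t)"
  unfolding evaluates_def by (intro allI run_intros)+

lemma evaluates_proj: "i < length xs \<Longrightarrow> evaluates ((iseq itail ^^ i) ihead) (enc xs) (xs ! i)"
proof (induction i arbitrary: xs)
  case 0
  then show ?case using evaluates_basic(3)[of "enc xs"] by (cases xs) auto
next
  case (Suc i)
  then obtain x ys where "xs = x # ys" by (cases xs) auto
  then show ?case
    using Suc evaluates_iseq[OF evaluates_basic(4)[of "enc xs"], of "(iseq itail ^^ i) ihead"] by auto
qed

lemma evaluates_itup:
  "list_all2 (\<lambda>g y. evaluates g t y) gs ys \<Longrightarrow> evaluates (itup gs) t (enc ys)"
proof (induction rule: list_all2_induct)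
  case Nil
  then show ?case by (simp add: itup_def evaluates_basic)
next
  case (Cons g gs y ys)
  let ?l = "itup gs"
  have "evaluates (iseq idup (iseq ?l (iseq iswap (iseq g icons)))) t (pair y (enc ys))"
    unfolding evaluates_def
    by (intro allI run_intros run_evaluates[OF Cons.IH] run_evaluates[OF Cons.hyps(1)])
  then show ?case by (simp add: itup_def)
qed

text \<open>The machine follows each halting computation, by induction on its derivation. The
  diagonal argument applies this to a program that decides a relation.\<close>

lemma evaluates_compile: "computes f xs y \<Longrightarrow> evaluates (compile f) (enc xs) y"
proof (induction rule: computes.induct)
  case (zero xs)
  then show ?case by (simp add: evaluates_basic)
next
  case (succ x)
  then show ?case
    using evaluates_iseq[OF evaluates_basic(3,2), of "enc [x]"] by simp
next
  case (proj i xs)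
  then show ?case by (simp add: evaluates_proj)
next
  case (comp xs gs ys f z)
  have "list_all2 (\<lambda>g y. evaluates g (enc xs) y) (map compile gs) ys"
    using comp.IH(1) by (auto simp: list_all2_conv_all_nth)
  then show ?case
    using comp.IH(2) by (auto intro: evaluates_iseq evaluates_itup)
next
  case (prec_0 f xs y g)
  then show ?case
    unfolding evaluates_def[of "compile (Prec f g)"]
    by (auto intro!: run_intros run_evaluates)
next
  case (prec_Suc f g n xs y z)
  have rec: "evaluates (iprec (compile f) (compile g)) (pair n (enc xs)) y"
    and g: "evaluates (compile g) (pair n (pair y (enc xs))) z"
    using prec_Suc.IH by simp_all
  have "run (pair (pair (iprec (compile f) (compile g)) k) (pair (pair (Suc n) (enc xs)) s))
      (pair k (pair z s))" for k s
    by (intro run_step[OF step_iprec_Suc] run_evaluates[OF rec] run_evaluates[OF g] run_intros)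
  then show ?case
    unfolding evaluates_def by simp
next
  case (mu f n xs)
  \<comment> \<open>Induction runs downwards from \<open>n\<close>: at \<open>n\<close> the test
    sees \<open>0\<close> and returns the counter, below \<open>n\<close> it sees a successor and
    passes to the next candidate.\<close>
  have loop: "run (pair (pair (iloop (compile f)) k) (pair (pair m (enc xs)) s)) (pair k (pair n s))"
    if "m \<le> n" for m k s
    using that
  proof (induction rule: inc_induct)
    case base
    have f: "evaluates (compile f) (pair n (enc xs)) 0" using mu.IH(1) by simp
    show ?case
      by (intro run_step[OF step_iloop] run_evaluates[OF f] run_step[OF step_itest_0] run_refl)
  next
    case (step m)
    obtain v where f: "evaluates (compile f) (pair m (enc xs)) (Suc v)"
      using mu.IH(2) step.hyps by auto
    show ?case
      by (intro run_step[OF step_iloop] run_evaluates[OF f] run_step[OF step_itest_Suc] step.IH)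
  qed
  show ?case
    unfolding evaluates_def compile.simps by (intro allI run_intros loop) simp
qed

section \<open>Running machine code on its own block\<close>

definition init :: "nat \<Rightarrow> nat" where
  "init e = pair (pair e 0) (pair (enc [2 * e, 2 * e + 1]) 0)"

lemma step_halted: "step (pair 0 s) = pair 0 s"
  by (simp add: step_def)

lemma funpow_step_halted: "(step ^^ n) (pair 0 s) = pair 0 s"
  by (induction n) (auto simp: step_halted)

text \<open>Halted configurations are fixed by \<open>step\<close>, so a run reaches at most one of
  them, and \<open>0\<close> is the one with value \<open>0\<close>.\<close>

lemma run_init_0_iff:
  assumes "computes f [2 * compile f, 2 * compile f + 1] v"
  shows "run (init (compile f)) 0 \<longleftrightarrow> v = 0"
proof
  have *: "run (init (compile f)) (pair 0 (pair v 0))"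
    using evaluatesD[OF evaluates_compile[OF assms]] unfolding init_def .
  show "run (init (compile f)) 0" if "v = 0" using * that by simp
  assume "run (init (compile f)) 0"
  \<comment> \<open>Writing \<open>0\<close> as \<open>pair 0 0\<close> shows it as a halted
    configuration.\<close>
  then obtain m n where mn: "(step ^^ m) (init (compile f)) = pair 0 0"
    "(step ^^ n) (init (compile f)) = pair 0 (pair v 0)"
    using * unfolding run_def by auto
  \<comment> \<open>After \<open>m + n\<close> steps the run still rests at either halted
    configuration, so the two agree.\<close>
  have "pair 0 (pair v 0) = (step ^^ (m + n)) (init (compile f))"
    by (simp add: funpow_add mn funpow_step_halted)
  also have "\<dots> = (step ^^ (n + m)) (init (compile f))" by (simp add: add.commute)
  also have "\<dots> = pair 0 0" by (subst funpow_add) (simp add: mn funpow_step_halted del: pair_0_0)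
  finally have "pair v 0 = 0" by (simp del: pair_0_0)
  then show "v = 0" using pfst_pair[of v 0] by simp
qed

section \<open>The diagonal equivalence relation\<close>

text \<open>Every number \<open>x div 2\<close> is run as machine code, even if no program compiles
  to it.\<close>

definition diag :: "nat rel" where
  "diag = {(x, y). x = y \<or> x div 2 = y div 2 \<and> run (init (x div 2)) 0}"

lemma equiv_diag: "equiv UNIV diag"
  by (rule equivI) (auto simp: diag_def refl_on_def sym_def trans_def)

lemma semi_decidable_diag: "semi_decidable_rel diag"
proof (rule semi_decidable_rel_search)
  \<comment> \<open>The search variable counts machine steps. The value is the configuration itself,
    since the sought configuration is the number \<open>0\<close>.\<close>
  let ?f = "\<lambda>xs. if xs ! 1 = xs ! 2 then 0
     else if xs ! 1 div 2 = xs ! 2 div 2 then (step ^^ (xs ! 0)) (init (xs ! 1 div 2)) else 1"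
  show "recursive 3 ?f"
    \<comment> \<open>\<open>mult_2\<close> turns doubling into an addition, for which a rule is at
      hand.\<close>
    unfolding init_def enc_simps mult_2
    by (intro recursive_intros recursive_funpow recursive_step) auto
  show "(x, y) \<in> diag \<longleftrightarrow> (\<exists>n. ?f [n, x, y] = 0)" for x y
    by (auto simp: diag_def run_def)
qed

lemma FC_diag: "FC diag"
  unfolding FC_def
proof
  fix C assume "C \<in> UNIV // diag"
  then obtain x where "C = diag `` {x}" by (auto elim: quotientE)
  then have "C \<subseteq> {..x + 1}" by (auto simp: diag_def)
  then show "finite C" using finite_subset by blast
qed

text \<open>The program deciding \<open>D\<close> is run on the block indexed by its own code: the
  machine ends in \<open>0\<close> exactly when the program denies that \<open>D\<close> relates the
  block's elements.\<close>

lemma diag_not_generated: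
  assumes "decidable_rel D" "D \<subseteq> diag" "diag \<subseteq> D\<^sup>*"
  shows False
proof -
  obtain f where f: "\<And>x y. computes f [x, y] (if (x, y) \<in> D then 1 else 0)"
    using assms(1) unfolding decidable_rel_def by blast
  define e where "e = compile f"
  have diag_iff: "(2 * e, 2 * e + 1) \<in> diag \<longleftrightarrow> (2 * e, 2 * e + 1) \<notin> D"
    using run_init_0_iff[OF f] unfolding e_def by (simp add: diag_def)
  then have notin: "(2 * e, 2 * e + 1) \<notin> D" and "(2 * e, 2 * e + 1) \<in> D\<^sup>*"
    using assms(2,3) by blast+
  \<comment> \<open>A path in \<open>D\<close> cannot leave \<open>2 * e\<close>: edges stay inside
    the block, and the one edge to its other element is missing.\<close>
  have "z = 2 * e" if "(2 * e, z) \<in> D\<^sup>*" for z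
    using that
  proof (induction rule: rtrancl_induct)
    case (step y z)
    then have "(2 * e, z) \<in> D" "z div 2 = e" using assms(2) by (auto simp: diag_def)
    then show ?case using notin by (cases "even z") (auto elim!: evenE oddE)
  qed simp
  with \<open>(2 * e, 2 * e + 1) \<in> D\<^sup>*\<close> show False by force
qed

section \<open>Composition compared with join\<close>

lemma foldr_relcomp_subset: "foldr (O) Hs Id \<subseteq> (\<Union> (set Hs))\<^sup>*"
proof (induction Hs)
  case (Cons H Hs)
  let ?U = "\<Union> (set (H # Hs))"
  have "(\<Union> (set Hs))\<^sup>* \<subseteq> ?U\<^sup>*" by (intro rtrancl_mono) auto
  with Cons have "foldr (O) Hs Id \<subseteq> ?U\<^sup>*" by blast
  moreover have "H \<subseteq> ?U\<^sup>*" by auto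
  ultimately have "H O foldr (O) Hs Id \<subseteq> ?U\<^sup>* O ?U\<^sup>*" by (intro relcomp_mono)
  then show ?case by simp
qed simp

lemma refl_foldr_relcomp: "\<forall>H\<in>set Hs. refl H \<Longrightarrow> refl (foldr (O) Hs Id)"
  by (induction Hs) (auto simp: refl_Id intro: refl_onI dest: refl_onD)

text \<open>A step in one factor is a step in the composition, because reflexivity lets all the
  other factors stand still.\<close>

lemma Union_subset_foldr_relcomp:
  "\<forall>H\<in>set Hs. refl H \<Longrightarrow> \<Union> (set Hs) \<subseteq> foldr (O) Hs Id"
proof (induction Hs)
  case (Cons H Hs)
  let ?F = "foldr (O) Hs Id"
  have "Id \<subseteq> H" "Id \<subseteq> ?F"
    using Cons.prems refl_foldr_relcomp[of Hs] by (auto dest: refl_onD)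
  then have "H \<subseteq> H O ?F" "?F \<subseteq> H O ?F" by auto
  then show ?case using Cons by auto
qed simp

theorem corollary1:
  "\<exists>E :: nat rel.
     equiv UNIV E \<and> semi_decidable_rel E \<and> FC E \<and>
     \<not> (\<exists>n (Hs :: nat rel list). n > 1 \<and> length Hs = n \<and>
          (\<forall>H \<in> set Hs. equiv UNIV H \<and> decidable_rel H) \<and>
          E = (\<Union> (set Hs))\<^sup>+) \<and>
     \<not> (\<exists>n (Hs :: nat rel list). n > 1 \<and> length Hs = n \<and>
          (\<forall>H \<in> set Hs. equiv UNIV H \<and> decidable_rel H) \<and>
          E = foldr (O) Hs Id)"
proof -
  \<comment> \<open>In (a) and (b) alike the union of the relations serves as \<open>D\<close>; each
    case only has to place \<open>diag\<close> between this union and its closure.\<close>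
  have not_generated: False
    if "\<forall>H \<in> set Hs. equiv UNIV H \<and> decidable_rel H"
      "\<Union> (set Hs) \<subseteq> diag" "diag \<subseteq> (\<Union> (set Hs))\<^sup>*" for Hs
    using that decidable_rel_Union[of Hs] diag_not_generated by blast
  have "diag \<noteq> (\<Union> (set Hs))\<^sup>+" if "\<forall>H \<in> set Hs. equiv UNIV H \<and> decidable_rel H" for Hs
  proof
    assume "diag = (\<Union> (set Hs))\<^sup>+"
    then have "\<Union> (set Hs) \<subseteq> diag" "diag \<subseteq> (\<Union> (set Hs))\<^sup>*" by auto
    then show False using not_generated[OF that] by blast
  qed
  moreover have "diag \<noteq> foldr (O) Hs Id"
    if "\<forall>H \<in> set Hs. equiv UNIV H \<and> decidable_rel H" for Hs
    using not_generated[OF that] foldr_relcomp_subset[of Hs] Union_subset_foldr_relcomp[of Hs] that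
    by (metis equiv_def)
  ultimately show ?thesis
    using equiv_diag semi_decidable_diag FC_diag by blast
qed

end
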